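(* A positive, interior or positive, boundary $(2t-1)$-cubature formula $F$ on the simplex $\Delta_n$ is an $\epsilon$-net with respect to the metric $$ds^2=\frac{dx_0^2}{2x_0}+\frac{dx_1^2}{2x_1}+\cdots+\frac{dx_n^2}{2x_n}$$ in barycentric coordinates, where $\cos 2\epsilon$ is the highest zero of the Jacobi polynomial $P^{(n-1,0)}_t(x)$.
   Context: $\Delta_n=\{(x_0,\ldots,x_n):x_k\ge0,\ \sum x_k=1\}$ is the $n$-simplex in barycentric coordinates, with uniform measure $\mu$ normalized to total measure $1$. A $d$-cubature formula on $\Delta_n$ is a finite set of points $F=\{p_a\}$ with real weights $w_a$ such that $\int P\,d\mu=\sum_a w_aP(p_a)$ for all polynomials $P$ of degree at most $d$; it is positive if all $w_a>0$, interior if all points lie in the interior of $\Delta_n$, and boundary if all points lie in $\Delta_n$ and some lie on $\partial\Delta_n$. $F$ is an $\epsilon$-net if every point of $\Delta_n$ is within distance $\epsilon$ of some point of $F$. Here $0<\epsilon<\pi/2$. $P^{(a,b)}_t$ is the degree-$t$ Jacobi polynomial, orthogonal on $[-1,1]$ with respect to the weight $(1-x)^a(1+x)^b$.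
   Formalization: The metric is corrected to ds² = Σ dx_k²/(4x_k) in place of Σ dx_k²/(2x_k); with the printed metric the claim fails for n = t = 1 and F = {midpoint}, where ε = π/4 but the distance to an endpoint is π/(2√2). *)

theory Defs
  imports "HOL-Analysis.Analysis" "HOL-Computational_Algebra.Polynomial"
begin

text \<open>
  The dimension is \<open>n = CARD('n)\<close>. Barycentric coordinates are indexed by \<^typ>\<open>'n option\<close>,
  with \<^const>\<open>None\<close> as the index of \<open>x\<^sub>0\<close>.
\<close>

definition std_simplex :: "(real ^ ('n::finite option)) set" where
  "std_simplex = {x. (\<forall>k. 0 \<le> x $ k) \<and> (\<Sum>k\<in>UNIV. x $ k) = 1}"

definition barycentric :: "real ^ 'n \<Rightarrow> real ^ ('n::finite option)" where
  "barycentric y = (\<chi> k. case k of None \<Rightarrow> 1 - (\<Sum>i\<in>UNIV. y $ i) | Some i \<Rightarrow> y $ i)"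

text \<open>
  The chart \<^const>\<open>barycentric\<close> is affine, so it carries normalized Lebesgue measure to the
  uniform probability measure on the simplex.
\<close>

definition simplex_measure :: "(real ^ ('n::finite option)) measure" where
  "simplex_measure =
     distr (uniform_measure lborel {y. barycentric y \<in> std_simplex}) borel barycentric"

definition polynomials_upto :: "nat \<Rightarrow> (real ^ 'm \<Rightarrow> real) set" where
  "polynomials_upto d =
     {P. \<exists>c :: ('m::finite \<Rightarrow> nat) \<Rightarrow> real.
           P = (\<lambda>x. \<Sum>\<alpha> | (\<Sum>k\<in>UNIV. \<alpha> k) \<le> d. c \<alpha> * (\<Prod>k\<in>UNIV. (x $ k) ^ \<alpha> k))}"

definition cubature_formula ::
    "nat \<Rightarrow> (real ^ ('n::finite option)) set \<Rightarrow> (real ^ ('n option) \<Rightarrow> real) \<Rightarrow> bool" where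
  "cubature_formula d F w \<longleftrightarrow>
     finite F \<and>
     (\<forall>P \<in> polynomials_upto d. (\<integral>x. P x \<partial>simplex_measure) = (\<Sum>p\<in>F. w p * P p))"

definition positive_weights :: "'a set \<Rightarrow> ('a \<Rightarrow> real) \<Rightarrow> bool" where
  "positive_weights F w \<longleftrightarrow> (\<forall>p\<in>F. w p > 0)"

definition interior_points :: "(real ^ ('n::finite option)) set \<Rightarrow> bool" where
  "interior_points F \<longleftrightarrow> F \<subseteq> rel_interior std_simplex"

definition boundary_points :: "(real ^ ('n::finite option)) set \<Rightarrow> bool" where
  "boundary_points F \<longleftrightarrow> F \<subseteq> std_simplex \<and> F \<inter> rel_frontier std_simplex \<noteq> {}"

text \<open>
  Length of a path in the simplex for \<open>ds\<^sup>2 = (\<Sum>k. dx\<^sub>k\<^sup>2 / (c x\<^sub>k))\<close>. A coordinate \<open>\<gamma>\<^sub>k \<ge> 0\<close> that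
  vanishes at an inner point of differentiability has derivative 0 there, so the convention
  \<open>x / 0 = 0\<close> contributes nothing beyond the metric of the face on which the path runs.

  For \<open>c = 4\<close> the substitution \<open>x\<^sub>k = r\<^sub>k\<^sup>2\<close> turns the metric into \<open>(\<Sum>k. dr\<^sub>k\<^sup>2)\<close> on the unit sphere,
  that is, into the quotient of the Fubini--Study metric of diameter \<open>pi / 2\<close>, for which \<open>cos (2 * \<theta>)\<close>
  is the argument of the zonal Jacobi polynomials. The source prints \<open>2 x\<^sub>k\<close> instead of
  \<open>4 x\<^sub>k\<close>, which multiplies all distances by \<open>sqrt 2\<close>. With that constant the covering claim fails
  for \<open>n = t = 1\<close>: the midpoint with weight 1 is a 1-cubature formula on the segment, the zero of
  the first Legendre polynomial gives \<open>\<epsilon> = pi / 4\<close>, but the distance from the midpoint to an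
  end point is \<open>pi / (2 * sqrt 2)\<close>; with \<open>c = 4\<close> it is exactly \<open>pi / 4\<close>.
\<close>

definition simplex_length :: "real \<Rightarrow> (real \<Rightarrow> real ^ ('n::finite option)) \<Rightarrow> ennreal" where
  "simplex_length c \<gamma> =
     (\<integral>\<^sup>+ s\<in>{0..1}. ennreal (sqrt
        (\<Sum>k\<in>UNIV. (vector_derivative \<gamma> (at s) $ k)\<^sup>2 / (c * \<gamma> s $ k))) \<partial>lborel)"

definition simplex_dist ::
    "real \<Rightarrow> real ^ ('n::finite option) \<Rightarrow> real ^ ('n option) \<Rightarrow> ennreal" where
  "simplex_dist c x y =
     Inf {simplex_length c \<gamma> | \<gamma>. \<gamma> piecewise_C1_differentiable_on {0..1} \<and>
            path_image \<gamma> \<subseteq> std_simplex \<and> pathstart \<gamma> = x \<and> pathfinish \<gamma> = y}"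

definition simplex_net :: "real \<Rightarrow> real \<Rightarrow> (real ^ ('n::finite option)) set \<Rightarrow> bool" where
  "simplex_net c \<epsilon> F \<longleftrightarrow> (\<forall>x\<in>std_simplex. \<exists>p\<in>F. simplex_dist c x p \<le> ennreal \<epsilon>)"

text \<open>
  This determines the Jacobi polynomial up to a nonzero scalar factor (for \<open>a, b > -1\<close>), hence
  determines its zeros.
\<close>

definition jacobi_polynomial :: "real \<Rightarrow> real \<Rightarrow> nat \<Rightarrow> real poly \<Rightarrow> bool" where
  "jacobi_polynomial a b t p \<longleftrightarrow>
     p \<noteq> 0 \<and> degree p = t \<and>
     (\<forall>q. degree q < t \<longrightarrow>
        (LBINT x:{-1..1}. poly p x * poly q x * ((1 - x) powr a * (1 + x) powr b)) = 0)"

definition highest_zero :: "real poly \<Rightarrow> real \<Rightarrow> bool" where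
  "highest_zero p z \<longleftrightarrow> poly p z = 0 \<and> (\<forall>x. poly p x = 0 \<longrightarrow> x \<le> z)"

end

theory Submission
  imports Defs
begin

text \<open>
  Fix a point \<open>x\<close> of the simplex. Averaging \<open>g (2 \<bar>\<Sum>k. sqrt (x\<^sub>k p\<^sub>k) \<omega>\<^sub>k\<bar>\<^sup>2 - 1)\<close> over the phases
  \<open>\<omega>\<^sub>k\<close> turns a polynomial \<open>g\<close> in one variable into a polynomial in \<open>p\<close> of at most the same degree,
  whose mean over the simplex is the mean of \<open>g\<close> for the weight \<open>(1 - u)\<^sup>n\<^sup>-\<^sup>1\<close> on \<open>[-1, 1]\<close>.
  Let \<open>z\<close> be a zero of the Jacobi polynomial \<open>J = (u - z) q\<close> and take \<open>g = (u - z) q\<^sup>2 = J q\<close>: its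
  mean vanishes by orthogonality. If \<open>2 (\<Sum>k. sqrt (x\<^sub>k p\<^sub>k))\<^sup>2 - 1 < z\<close> at all cubature points \<open>p\<close>,
  every term of the cubature sum is nonpositive, hence zero, so \<open>q\<close> vanishes at all
  arguments that occur; then the cubature sum for \<open>q\<^sup>2\<close> is zero as well, although the mean of \<open>q\<^sup>2\<close> is
  positive. So some \<open>p\<close> has \<open>arccos (\<Sum>k. sqrt (x\<^sub>k p\<^sub>k)) \<le> \<epsilon>\<close>, and squaring the
  coordinates of a great circle arc from \<open>sqrt x\<close> to \<open>sqrt p\<close> gives a path of that length.
\<close>

section \<open>Multinomial expansion\<close>

lemma binomial_divided_powers:
  fixes a b :: "'a::field_char_0"
  shows "(a + b) ^ m / fact m = (\<Sum>j\<le>m. (a ^ j / fact j) * (b ^ (m - j) / fact (m - j)))"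
proof -
  have "(a + b) ^ m / fact m = (\<Sum>j\<le>m. of_nat (m choose j) * a ^ j * b ^ (m - j) / fact m)"
    by (simp add: binomial_ring sum_divide_distrib)
  also have "\<dots> = (\<Sum>j\<le>m. (a ^ j / fact j) * (b ^ (m - j) / fact (m - j)))"
    by (intro sum.cong) (auto simp: binomial_fact field_simps)
  finally show ?thesis .
qed

lemma finite_multi_indices_le:
  "finite {\<alpha> :: 'k::finite \<Rightarrow> nat. (\<Sum>k\<in>UNIV. \<alpha> k) \<le> d}"
proof (rule finite_subset)
  show "{\<alpha> :: 'k \<Rightarrow> nat. (\<Sum>k\<in>UNIV. \<alpha> k) \<le> d} \<subseteq> PiE UNIV (\<lambda>_. {..d})"
  proof
    fix \<alpha> :: "'k \<Rightarrow> nat" assume "\<alpha> \<in> {\<alpha>. (\<Sum>k\<in>UNIV. \<alpha> k) \<le> d}"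
    moreover have "\<alpha> k \<le> (\<Sum>k\<in>UNIV. \<alpha> k)" for k
      by (rule member_le_sum) auto
    ultimately show "\<alpha> \<in> PiE UNIV (\<lambda>_. {..d})"
      by (auto intro: order_trans)
  qed
qed (auto intro: finite_PiE)

text \<open>With every power divided by its factorial, splitting off the exponent of the new index
  is a plain convolution, so no multinomial coefficient has to be manipulated in the induction.
  Exponents are 0 outside \<open>S\<close>, which makes a multi-index determined by its values on
  \<open>S\<close>. Finiteness of the index set is proved along with the identity, because splitting
  the double sum relies on it.\<close>

lemma multinomial_divided_powers_on:
  fixes x :: "'k \<Rightarrow> 'a::field_char_0"
  assumes "finite S"
  shows "finite {\<alpha>. (\<forall>i. i \<notin> S \<longrightarrow> \<alpha> i = 0) \<and> sum \<alpha> S = m} \<and> (\<Sum>k\<in>S. x k) ^ m / fact m =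
     (\<Sum>\<alpha> | (\<forall>i. i \<notin> S \<longrightarrow> \<alpha> i = 0) \<and> sum \<alpha> S = m. \<Prod>k\<in>S. x k ^ \<alpha> k / fact (\<alpha> k))"
  using assms
proof (induction S arbitrary: m rule: finite_induct)
  case empty
  have "{\<alpha>. (\<forall>i. i \<notin> {} \<longrightarrow> \<alpha> i = 0) \<and> sum \<alpha> {} = m} = (if m = 0 then {\<lambda>i::'k. 0::nat} else {})"
    by auto
  then show ?case by simp
next
  case (insert k A)
  define D where "D = (\<lambda>S m. {\<alpha> :: 'k \<Rightarrow> nat. (\<forall>i. i \<notin> S \<longrightarrow> \<alpha> i = 0) \<and> sum \<alpha> S = m})"
  \<comment> \<open>A multi-index on \<open>insert k A\<close> is its exponent \<open>j\<close> at
    \<open>k\<close> together with a multi-index on \<open>A\<close>; the inverse map resets the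
    value at \<open>k\<close> to 0.\<close>
  define f where "f = (\<lambda>(j, \<beta> :: 'k \<Rightarrow> nat). \<beta>(k := j))"
  have [simp]: "(\<Sum>i\<in>A. if i = k then j else \<beta> i) = sum \<beta> A" for j and \<beta> :: "'k \<Rightarrow> nat"
    using insert.hyps by (intro sum.cong) auto
  have bij: "bij_betw f (Sigma {..m} (\<lambda>j. D A (m - j))) (D (insert k A) m)"
  proof (rule bij_betw_byWitness[where f' = "\<lambda>\<alpha>. (\<alpha> k, \<alpha>(k := 0))"])
    show "f ` Sigma {..m} (\<lambda>j. D A (m - j)) \<subseteq> D (insert k A) m"
      using insert.hyps by (auto simp: D_def f_def)
    show "(\<lambda>\<alpha>. (\<alpha> k, \<alpha>(k := 0))) ` D (insert k A) m \<subseteq> Sigma {..m} (\<lambda>j. D A (m - j))"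
      using insert.hyps by (auto simp: D_def)
    show "\<forall>a\<in>Sigma {..m} (\<lambda>j. D A (m - j)). (f a k, (f a)(k := 0)) = a"
      using insert.hyps by (auto simp: D_def f_def fun_eq_iff)
    show "\<forall>\<alpha>\<in>D (insert k A) m. f (\<alpha> k, \<alpha>(k := 0)) = \<alpha>"
      by (auto simp: f_def)
  qed
  have fin: "finite (D A j)" for j
    using insert.IH unfolding D_def by blast
  have IH: "(\<Sum>k\<in>A. x k) ^ j / fact j = (\<Sum>\<alpha>\<in>D A j. \<Prod>k\<in>A. x k ^ \<alpha> k / fact (\<alpha> k))" for j
    using insert.IH unfolding D_def by blast
  have "(\<Sum>k\<in>insert k A. x k) ^ m / fact m =
      (\<Sum>j\<le>m. (x k ^ j / fact j) * ((\<Sum>k\<in>A. x k) ^ (m - j) / fact (m - j)))"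
    using insert.hyps by (simp add: binomial_divided_powers)
  also have "\<dots> = (\<Sum>j\<le>m. \<Sum>\<beta>\<in>D A (m - j). (x k ^ j / fact j) * (\<Prod>k\<in>A. x k ^ \<beta> k / fact (\<beta> k)))"
    by (simp add: IH sum_distrib_left)
  also have "\<dots> = (\<Sum>(j, \<beta>)\<in>Sigma {..m} (\<lambda>j. D A (m - j)).
      (x k ^ j / fact j) * (\<Prod>k\<in>A. x k ^ \<beta> k / fact (\<beta> k)))"
    by (subst sum.Sigma) (auto simp: fin)
  also have "\<dots> = (\<Sum>p\<in>Sigma {..m} (\<lambda>j. D A (m - j)). \<Prod>i\<in>insert k A. x i ^ f p i / fact (f p i))"
  proof (intro sum.cong refl, clarify)
    fix j \<beta>
    have "(\<Prod>i\<in>A. x i ^ \<beta> i / fact (\<beta> i)) = (\<Prod>i\<in>A. x i ^ f (j, \<beta>) i / fact (f (j, \<beta>) i))"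
      using insert.hyps by (intro prod.cong) (auto simp: f_def)
    then show "(x k ^ j / fact j) * (\<Prod>k\<in>A. x k ^ \<beta> k / fact (\<beta> k)) =
        (\<Prod>i\<in>insert k A. x i ^ f (j, \<beta>) i / fact (f (j, \<beta>) i))"
      using insert.hyps by (simp add: f_def)
  qed
  also have "\<dots> = (\<Sum>\<alpha>\<in>D (insert k A) m. \<Prod>i\<in>insert k A. x i ^ \<alpha> i / fact (\<alpha> i))"
    by (rule sum.reindex_bij_betw[OF bij])
  finally show ?case
    using bij_betw_finite[OF bij] fin by (auto simp: D_def)
qed

definition multinomial_coeff :: "('k::finite \<Rightarrow> nat) \<Rightarrow> real" where
  "multinomial_coeff \<alpha> = fact (\<Sum>k\<in>UNIV. \<alpha> k) / (\<Prod>k\<in>UNIV. fact (\<alpha> k))"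

lemma multinomial_theorem:
  fixes x :: "'k::finite \<Rightarrow> 'a::real_field"
  shows "(\<Sum>k\<in>UNIV. x k) ^ m =
     (\<Sum>\<alpha> | (\<Sum>k\<in>UNIV. \<alpha> k) = m. of_real (multinomial_coeff \<alpha>) * (\<Prod>k\<in>UNIV. x k ^ \<alpha> k))"
proof -
  have "(\<Sum>k\<in>UNIV. x k) ^ m =
      fact m * (\<Sum>\<alpha> | (\<Sum>k\<in>UNIV. \<alpha> k) = m. \<Prod>k\<in>UNIV. x k ^ \<alpha> k / fact (\<alpha> k))"
    using multinomial_divided_powers_on[of "UNIV :: 'k set" m x] by (simp add: field_simps)
  also have "\<dots> = (\<Sum>\<alpha> | (\<Sum>k\<in>UNIV. \<alpha> k) = m. of_real (multinomial_coeff \<alpha>) * (\<Prod>k\<in>UNIV. x k ^ \<alpha> k))"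
    unfolding sum_distrib_left
    by (intro sum.cong) (auto simp: multinomial_coeff_def prod_dividef)
  finally show ?thesis .
qed

section \<open>Beta and Dirichlet integrals\<close>

text \<open>Integration by parts moves one factor \<open>b - y\<close> over to \<open>y - a\<close>,
  which is why \<open>i\<close> is arbitrary in the induction on \<open>j\<close>. The boundary
  terms vanish, since both exponents of the antiderivative are positive.\<close>

lemma has_integral_beta_powers:
  fixes a b :: real
  assumes "a \<le> b"
  shows "((\<lambda>y. (y - a) ^ i * (b - y) ^ j) has_integral
    (fact i * fact j / fact (i + j + 1) * (b - a) ^ (i + j + 1))) {a..b}"
proof (induction j arbitrary: i)
  case 0
  have "((\<lambda>y. (y - a) ^ Suc i / real (Suc i)) has_real_derivative (y - a) ^ i) (at y within {a..b})" for y
    by (rule derivative_eq_intros refl | simp del: of_nat_Suc)+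
  then have "((\<lambda>y. (y - a) ^ i) has_integral
      ((b - a) ^ Suc i / real (Suc i) - (a - a) ^ Suc i / real (Suc i))) {a..b}"
    using assms by (intro fundamental_theorem_of_calculus)
      (auto simp flip: has_real_derivative_iff_has_vector_derivative)
  then show ?case by (simp del: of_nat_Suc)
next
  case (Suc j)
  have "((\<lambda>y. (y - a) ^ Suc i * (b - y) ^ Suc j) has_real_derivative
      real (Suc i) * ((y - a) ^ i * (b - y) ^ Suc j) - real (Suc j) * ((y - a) ^ Suc i * (b - y) ^ j))
      (at y within {a..b})" for y
    by (rule derivative_eq_intros refl | simp del: of_nat_Suc power_Suc)+
  then have "((\<lambda>y. real (Suc i) * ((y - a) ^ i * (b - y) ^ Suc j) -
      real (Suc j) * ((y - a) ^ Suc i * (b - y) ^ j))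
     has_integral ((b - a) ^ Suc i * (b - b) ^ Suc j - (a - a) ^ Suc i * (b - a) ^ Suc j)) {a..b}"
    using assms by (intro fundamental_theorem_of_calculus)
      (auto simp flip: has_real_derivative_iff_has_vector_derivative simp del: of_nat_Suc power_Suc)
  from has_integral_add[OF this has_integral_mult_right[OF Suc.IH[of "Suc i"], of "real (Suc j)"]]
  have "((\<lambda>y. real (Suc i) * ((y - a) ^ i * (b - y) ^ Suc j)) has_integral
      real (Suc j) * (fact (Suc i) * fact j / fact (Suc i + j + 1) * (b - a) ^ (Suc i + j + 1))) {a..b}"
    by simp
  from has_integral_mult_right[OF this, of "1 / real (Suc i)"]
  have "((\<lambda>y. (y - a) ^ i * (b - y) ^ Suc j) has_integral
      1 / real (Suc i) * (real (Suc j) * (fact (Suc i) * fact j / fact (Suc i + j + 1) *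
        (b - a) ^ (Suc i + j + 1)))) {a..b}"
    by (simp del: of_nat_Suc power_Suc)
  \<comment> \<open>The cancellation is stated for abstract reals, so that no factorial gets
    unfolded.\<close>
  moreover have "1 / p * (q * (p * u * v / F * G)) = u * (q * v) / F * G"
    if "p \<noteq> 0" for p q u v F G :: real
    using that by simp
  from this[of "real (Suc i)" "real (Suc j)" "fact i" "fact j", OF of_nat_neq_0]
  have "1 / real (Suc i) * (real (Suc j) * (fact (Suc i) * fact j / F * G)) =
      fact i * fact (Suc j) / F * G" for F G :: real
    unfolding fact_Suc by blast
  moreover have "Suc i + j + 1 = i + Suc j + 1" by simp
  ultimately show ?case by (simp only:)
qed

text \<open>By Fubini the newest coordinate is integrated first. It runs over an interval whose
  length is what the others leave of 1, and its beta integral raises the exponent of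
  \<open>1 - sum x A\<close> from \<open>m\<close> to \<open>a b + m + 1\<close>; hence
  \<open>m\<close> is arbitrary. This last factor later plays the part of the barycentric coordinate
  with index \<open>None\<close>.\<close>

lemma nn_integral_dirichlet_PiM:
  fixes a :: "'i \<Rightarrow> nat"
  assumes "finite A"
  shows "(\<integral>\<^sup>+ x. ennreal (if (\<forall>i\<in>A. 0 \<le> x i) \<and> sum x A \<le> 1
      then (\<Prod>i\<in>A. x i ^ a i) * (1 - sum x A) ^ m else 0) \<partial>PiM A (\<lambda>_. lborel)) =
    ennreal ((\<Prod>i\<in>A. fact (a i)) * fact m / fact (card A + sum a A + m))"
  using assms
proof (induction A arbitrary: m rule: finite_induct)
  case empty
  then show ?case by (simp add: PiM_empty nn_integral_count_space_finite)
next
  case (insert b A)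
  interpret product_sigma_finite "\<lambda>_. lborel :: real measure"
    by standard
  define f where "f = (\<lambda>A m x. if (\<forall>i\<in>A. 0 \<le> x i) \<and> sum x A \<le> (1::real)
      then (\<Prod>i\<in>A. x i ^ a i) * (1 - sum x A) ^ m else 0)"
  define c :: real where "c = fact (a b) * fact m / fact (a b + m + 1)"
  have c: "0 \<le> c" by (simp add: c_def)
  have meas: "(\<lambda>x. ennreal (f B m x)) \<in> borel_measurable (PiM B (\<lambda>_. lborel))" if "finite B" for B m
    unfolding f_def using that by measurable
  have inner: "(\<integral>\<^sup>+ y. ennreal (f (insert b A) m (x(b := y))) \<partial>lborel) = ennreal c * ennreal (f A (a b + m + 1) x)"
    for x
  proof -
    have upd: "sum (x(b := y)) A = sum x A" "(\<Prod>i\<in>A. (x(b := y)) i ^ a i) = (\<Prod>i\<in>A. x i ^ a i)"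
      "(\<forall>i\<in>A. 0 \<le> (x(b := y)) i) \<longleftrightarrow> (\<forall>i\<in>A. 0 \<le> x i)" for y
      using insert.hyps by (auto intro!: sum.cong prod.cong)
    show ?thesis
    proof (cases "(\<forall>i\<in>A. 0 \<le> x i) \<and> sum x A \<le> 1")
      case True
      define r where "r = 1 - sum x A"
      define g where "g = (\<lambda>y. if y \<in> {0..r} then (\<Prod>i\<in>A. x i ^ a i) * (y ^ a b * (r - y) ^ m) else 0)"
      have eq: "f (insert b A) m (x(b := y)) = g y" for y
        using insert.hyps True unfolding f_def g_def r_def
        by (simp add: upd del: fun_upd_apply) (auto simp: algebra_simps)
      have "((\<lambda>y. (\<Prod>i\<in>A. x i ^ a i) * (y ^ a b * (r - y) ^ m)) has_integral
          (\<Prod>i\<in>A. x i ^ a i) * (c * r ^ (a b + m + 1))) {0..r}"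
        using has_integral_mult_right[OF has_integral_beta_powers[of 0 r "a b" m], of "\<Prod>i\<in>A. x i ^ a i"] True
        by (simp add: c_def r_def)
      then have "(g has_integral (\<Prod>i\<in>A. x i ^ a i) * (c * r ^ (a b + m + 1))) UNIV"
        unfolding g_def by (simp only: has_integral_restrict_UNIV)
      moreover have "g \<in> borel_measurable borel"
        unfolding g_def by measurable
      moreover have "0 \<le> g y" for y
        using True by (auto simp: g_def intro!: mult_nonneg_nonneg prod_nonneg)
      ultimately have "(\<integral>\<^sup>+ y. ennreal (g y) \<partial>lborel) = ennreal ((\<Prod>i\<in>A. x i ^ a i) * (c * r ^ (a b + m + 1)))"
        by (intro nn_integral_has_integral_lborel)
      also have "\<dots> = ennreal (c * f A (a b + m + 1) x)"
        using True by (simp add: f_def r_def mult_ac)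
      finally show ?thesis
        unfolding eq by (simp only: ennreal_mult'[OF c])
    next
      case False
      then have "f (insert b A) m (x(b := y)) = 0" for y
        using insert.hyps unfolding f_def by (simp add: upd del: fun_upd_apply) auto
      then show ?thesis using False by (auto simp: f_def)
    qed
  qed
  have "(\<integral>\<^sup>+ x. ennreal (f (insert b A) m x) \<partial>PiM (insert b A) (\<lambda>_. lborel)) =
      (\<integral>\<^sup>+ x. (\<integral>\<^sup>+ y. ennreal (f (insert b A) m (x(b := y))) \<partial>lborel) \<partial>PiM A (\<lambda>_. lborel))"
    using insert.hyps by (intro product_nn_integral_insert meas) auto
  also have "\<dots> = ennreal c * (\<integral>\<^sup>+ x. ennreal (f A (a b + m + 1) x) \<partial>PiM A (\<lambda>_. lborel))"
    unfolding inner using insert.hyps by (intro nn_integral_cmult meas)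
  also have "(\<integral>\<^sup>+ x. ennreal (f A (a b + m + 1) x) \<partial>PiM A (\<lambda>_. lborel)) =
      ennreal ((\<Prod>i\<in>A. fact (a i)) * fact (a b + m + 1) / fact (card A + sum a A + (a b + m + 1)))"
    unfolding f_def by (rule insert.IH)
  also have "ennreal c * \<dots> = ennreal (c * ((\<Prod>i\<in>A. fact (a i)) * fact (a b + m + 1) / fact (card A + sum a A + (a b + m + 1))))"
    by (simp only: ennreal_mult'[OF c])
  also have "c * ((\<Prod>i\<in>A. fact (a i)) * fact (a b + m + 1) / fact (card A + sum a A + (a b + m + 1))) =
     (\<Prod>i\<in>insert b A. fact (a i)) * fact m / fact (card (insert b A) + sum a (insert b A) + m)"
  proof -
    have "card A + sum a A + (a b + m + 1) = card (insert b A) + sum a (insert b A) + m"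
      using insert.hyps by simp
    moreover have "u / F * (v * F / G) = u * v / G" if "F \<noteq> 0" for u v F G :: real
      using that by simp
    from this[OF fact_nonzero] have "c * ((\<Prod>i\<in>A. fact (a i)) * fact (a b + m + 1) / G) =
        (\<Prod>i\<in>insert b A. fact (a i)) * fact m / G" for G
      using insert.hyps by (simp add: c_def mult_ac del: fact_Suc)
    ultimately show ?thesis by (simp only:)
  qed
  finally show ?case
    unfolding f_def .
qed

section \<open>Averages over roots of unity\<close>

lemma sum_prod_functions:
  fixes f :: "'k::finite \<Rightarrow> nat \<Rightarrow> 'a::comm_semiring_1"
  shows "(\<Sum>\<theta>\<in>(UNIV \<rightarrow>\<^sub>E {..<N}). \<Prod>k\<in>UNIV. f k (\<theta> k)) = (\<Prod>k\<in>UNIV. \<Sum>j<N. f k j)"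
  by (simp add: prod_sum_PiE)

text \<open>The sum is geometric in an \<open>N\<close>-th root of unity. The bounds on
  \<open>a\<close> and \<open>b\<close> give \<open>|a - b| < N\<close>, so the ratio is 1 only for
  \<open>a = b\<close>.\<close>

lemma root_of_unity_orthogonality:
  assumes "a < N" "b < N"
  shows "(\<Sum>j<N. cis (2 * pi * real j / real N) ^ a * cnj (cis (2 * pi * real j / real N)) ^ b) =
    (if a = b then of_nat N else 0)"
proof (cases "a = b")
  case True
  have "cis x ^ b * cnj (cis x) ^ b = 1" for x
    by (simp add: cis_cnj cis_mult flip: power_mult_distrib)
  then show ?thesis using True by simp
next
  case False
  define \<zeta> where "\<zeta> = cis (2 * pi * (real a - real b) / real N)"
  have N: "0 < N" using assms by simp
  have "cis (2 * pi * real j / real N) ^ a * cnj (cis (2 * pi * real j / real N)) ^ b = \<zeta> ^ j" for j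
  proof -
    have "cis (real a * (2 * pi * real j / real N)) * cis (real b * - (2 * pi * real j / real N)) =
        cis (real j * (2 * pi * (real a - real b) / real N))"
      unfolding cis_mult by (rule arg_cong[where f = cis]) (simp add: field_simps N)
    then show ?thesis
      by (simp only: \<zeta>_def cis_cnj Complex.DeMoivre)
  qed
  moreover have "\<zeta> \<noteq> 1"
  proof
    assume "\<zeta> = 1"
    then have "cos (2 * pi * (real a - real b) / real N) = 1"
      by (simp add: \<zeta>_def complex_eq_iff)
    then obtain i :: int where "2 * pi * (real a - real b) / real N = of_int i * 2 * pi"
      by (auto simp: cos_one_2pi_int)
    then have "2 * pi * (real a - real b) = 2 * pi * (real_of_int i * real N)"
      using N by (simp add: field_simps)
    then have "real a - real b = real_of_int i * real N"
      by simp
    then have "real_of_int (int a - int b) = real_of_int (i * int N)"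
      by simp
    then have i: "int a - int b = i * int N"
      by (simp only: of_int_eq_iff)
    then have "i \<noteq> 0" using False by auto
    then have "int N \<le> \<bar>i * int N\<bar>" 
      using mult_right_mono[of 1 "\<bar>i\<bar>" "int N"] by (simp add: abs_mult)
    then show False using assms i by linarith
  qed
  moreover have "\<zeta> ^ N = 1"
  proof -
    have "\<zeta> ^ N = cis (2 * pi * real_of_int (int a - int b))"
      using N by (simp only: \<zeta>_def Complex.DeMoivre) simp
    also have "\<dots> = 1" by (intro cis_multiple_2pi) auto
    finally show ?thesis .
  qed
  ultimately show ?thesis using False
    by (simp add: geometric_sum)
qed

definition torus_sum :: "nat \<Rightarrow> ('k::finite \<Rightarrow> real) \<Rightarrow> ('k \<Rightarrow> nat) \<Rightarrow> complex" where
  "torus_sum N r \<theta> = (\<Sum>k\<in>UNIV. of_real (r k) * cis (2 * pi * real (\<theta> k) / real N))"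

text \<open>Trivial phases give the largest modulus, so a bound at these phases controls every
  argument that occurs in the average.\<close>

lemma cmod_torus_sum_le:
  assumes "\<And>k. 0 \<le> r k"
  shows "cmod (torus_sum N r \<theta>) \<le> (\<Sum>k\<in>UNIV. r k)"
  unfolding torus_sum_def
  by (rule sum_norm_le) (simp add: norm_mult assms)

text \<open>Expand the \<open>m\<close>-th power and its conjugate by the multinomial theorem.
  Orthogonality in each coordinate leaves only the pairs of equal multi-indices, and the exponents,
  being at most \<open>m < N\<close>, are too small for \<open>N\<close>-th roots of unity to be
  told apart from the full circle. Only the squares of the \<open>r k\<close> survive; for
  \<open>r k = sqrt (x $ k * p $ k)\<close> this removes the square roots.\<close>

lemma torus_average_power:
  fixes r :: "'k::finite \<Rightarrow> real"
  assumes "m < N"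
  shows "(\<Sum>\<theta>\<in>(UNIV \<rightarrow>\<^sub>E {..<N}). (cmod (torus_sum N r \<theta>))\<^sup>2 ^ m) / real N ^ CARD('k) =
    (\<Sum>\<alpha> | (\<Sum>k\<in>UNIV. \<alpha> k) = m. (multinomial_coeff \<alpha>)\<^sup>2 * (\<Prod>k\<in>UNIV. ((r k)\<^sup>2) ^ \<alpha> k))"
proof -
  let ?D = "{\<alpha> :: 'k \<Rightarrow> nat. (\<Sum>k\<in>UNIV. \<alpha> k) = m}"
  define c where "c = (\<lambda>j. cis (2 * pi * real j / real N))"
  define M where "M = (\<lambda>\<alpha>. complex_of_real (multinomial_coeff \<alpha> * (\<Prod>k\<in>UNIV. r k ^ \<alpha> k)))"
  have fin: "finite ?D"
    by (rule finite_subset[OF _ finite_multi_indices_le[of m]]) auto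
  have small: "\<alpha> k < N" if "\<alpha> \<in> ?D" for \<alpha> k
    using that member_le_sum[of k UNIV \<alpha>] assms by auto
  have pow: "torus_sum N r \<theta> ^ m = (\<Sum>\<alpha>\<in>?D. M \<alpha> * (\<Prod>k\<in>UNIV. c (\<theta> k) ^ \<alpha> k))" for \<theta>
    unfolding torus_sum_def multinomial_theorem
    by (intro sum.cong refl) (simp add: M_def c_def power_mult_distrib prod.distrib)
  have "complex_of_real ((cmod (torus_sum N r \<theta>))\<^sup>2 ^ m) =
      (\<Sum>\<alpha>\<in>?D. \<Sum>\<beta>\<in>?D. M \<alpha> * M \<beta> * (\<Prod>k\<in>UNIV. c (\<theta> k) ^ \<alpha> k * cnj (c (\<theta> k)) ^ \<beta> k))" for \<theta>
  proof -
    have "complex_of_real ((cmod (torus_sum N r \<theta>))\<^sup>2 ^ m) = torus_sum N r \<theta> ^ m * cnj (torus_sum N r \<theta> ^ m)"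
      using of_real_power[of "(cmod (torus_sum N r \<theta>))\<^sup>2" m, where 'a = complex]
      by (simp only: complex_norm_square power_mult_distrib complex_cnj_power)
    also have "\<dots> = (\<Sum>\<alpha>\<in>?D. \<Sum>\<beta>\<in>?D. (M \<alpha> * (\<Prod>k\<in>UNIV. c (\<theta> k) ^ \<alpha> k)) * cnj (M \<beta> * (\<Prod>k\<in>UNIV. c (\<theta> k) ^ \<beta> k)))"
      unfolding pow cnj_sum sum_product ..
    also have "\<dots> = (\<Sum>\<alpha>\<in>?D. \<Sum>\<beta>\<in>?D. M \<alpha> * M \<beta> * (\<Prod>k\<in>UNIV. c (\<theta> k) ^ \<alpha> k * cnj (c (\<theta> k)) ^ \<beta> k))"
      by (intro sum.cong refl) (simp add: M_def prod.distrib mult_ac)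
    finally show ?thesis .
  qed
  then have "complex_of_real (\<Sum>\<theta>\<in>(UNIV \<rightarrow>\<^sub>E {..<N}). (cmod (torus_sum N r \<theta>))\<^sup>2 ^ m) =
      (\<Sum>\<theta>\<in>(UNIV \<rightarrow>\<^sub>E {..<N}). \<Sum>\<alpha>\<in>?D. \<Sum>\<beta>\<in>?D. M \<alpha> * M \<beta> * (\<Prod>k\<in>UNIV. c (\<theta> k) ^ \<alpha> k * cnj (c (\<theta> k)) ^ \<beta> k))"
    by (simp only: of_real_sum)
  also have "\<dots> = (\<Sum>\<alpha>\<in>?D. \<Sum>\<theta>\<in>(UNIV \<rightarrow>\<^sub>E {..<N}). \<Sum>\<beta>\<in>?D.
      M \<alpha> * M \<beta> * (\<Prod>k\<in>UNIV. c (\<theta> k) ^ \<alpha> k * cnj (c (\<theta> k)) ^ \<beta> k))"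
    by (rule sum.swap)
  also have "\<dots> = (\<Sum>\<alpha>\<in>?D. \<Sum>\<beta>\<in>?D. \<Sum>\<theta>\<in>(UNIV \<rightarrow>\<^sub>E {..<N}).
      M \<alpha> * M \<beta> * (\<Prod>k\<in>UNIV. c (\<theta> k) ^ \<alpha> k * cnj (c (\<theta> k)) ^ \<beta> k))"
    by (rule sum.cong[OF refl], rule sum.swap)
  also have "\<dots> = (\<Sum>\<alpha>\<in>?D. \<Sum>\<beta>\<in>?D. M \<alpha> * M \<beta> *
      (\<Sum>\<theta>\<in>(UNIV \<rightarrow>\<^sub>E {..<N}). \<Prod>k\<in>UNIV. c (\<theta> k) ^ \<alpha> k * cnj (c (\<theta> k)) ^ \<beta> k))"
    by (simp only: sum_distrib_left)
  also have "\<dots> = (\<Sum>\<alpha>\<in>?D. \<Sum>\<beta>\<in>?D. if \<alpha> = \<beta> then M \<alpha> * M \<alpha> * of_nat N ^ CARD('k) else 0)"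
  proof (intro sum.cong refl)
    fix \<alpha> \<beta> assume \<alpha>: "\<alpha> \<in> ?D" and \<beta>: "\<beta> \<in> ?D"
    have "(\<Sum>\<theta>\<in>(UNIV \<rightarrow>\<^sub>E {..<N}). \<Prod>k\<in>UNIV. c (\<theta> k) ^ \<alpha> k * cnj (c (\<theta> k)) ^ \<beta> k) =
        (\<Prod>k\<in>UNIV. if \<alpha> k = \<beta> k then of_nat N else 0)"
      using sum_prod_functions[of "\<lambda>k j. c j ^ \<alpha> k * cnj (c j) ^ \<beta> k" N]
        root_of_unity_orthogonality[OF small[OF \<alpha>] small[OF \<beta>]] by (simp only: c_def)
    also have "\<dots> = (if \<alpha> = \<beta> then of_nat N ^ CARD('k) else 0)"
      by (auto simp: fun_eq_iff)
    finally show "M \<alpha> * M \<beta> * (\<Sum>\<theta>\<in>(UNIV \<rightarrow>\<^sub>E {..<N}). \<Prod>k\<in>UNIV. c (\<theta> k) ^ \<alpha> k * cnj (c (\<theta> k)) ^ \<beta> k) =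
        (if \<alpha> = \<beta> then M \<alpha> * M \<alpha> * of_nat N ^ CARD('k) else 0)"
      by simp
  qed
  also have "\<dots> = (\<Sum>\<alpha>\<in>?D. M \<alpha> * M \<alpha> * of_nat N ^ CARD('k))"
    by (intro sum.cong refl) (simp add: fin)
  also have "\<dots> = complex_of_real ((\<Sum>\<alpha>\<in>?D. (multinomial_coeff \<alpha>)\<^sup>2 * (\<Prod>k\<in>UNIV. ((r k)\<^sup>2) ^ \<alpha> k)) * real N ^ CARD('k))"
    unfolding sum_distrib_right of_real_sum
    by (intro sum.cong refl)
      (simp add: M_def power2_eq_square power_mult_distrib prod.distrib mult_ac)
  finally have "(\<Sum>\<theta>\<in>(UNIV \<rightarrow>\<^sub>E {..<N}). (cmod (torus_sum N r \<theta>))\<^sup>2 ^ m) =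
      (\<Sum>\<alpha>\<in>?D. (multinomial_coeff \<alpha>)\<^sup>2 * (\<Prod>k\<in>UNIV. ((r k)\<^sup>2) ^ \<alpha> k)) * real N ^ CARD('k)"
    by (simp only: of_real_eq_iff)
  then show ?thesis using assms by simp
qed

section \<open>Great circle arcs and the metric of the simplex\<close>

text \<open>If \<open>x_k = r_k^2\<close>, then \<open>dx_k^2 / (4 x_k) = dr_k^2\<close>. So
  squaring the coordinates of a great circle arc gives a path whose length is at most the angle, and
  one path suffices to bound the infimum. The arc stays on the unit sphere, hence its squares stay
  in the simplex.\<close>

lemma simplex_dist_le_arccos:
  fixes x p :: "real ^ ('n::finite option)"
  assumes x: "x \<in> std_simplex" and p: "p \<in> std_simplex"
  shows "simplex_dist 4 x p \<le> ennreal (arccos (\<Sum>k\<in>UNIV. sqrt (x $ k * p $ k)))"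
proof -
  define a :: "real ^ 'n option" where "a = (\<chi> k. sqrt (x $ k))"
  define b :: "real ^ 'n option" where "b = (\<chi> k. sqrt (p $ k))"
  have a2: "(a $ k)\<^sup>2 = x $ k" and b2: "(b $ k)\<^sup>2 = p $ k" for k
    using x p by (auto simp: a_def b_def std_simplex_def)
  have na: "a \<bullet> a = 1" and nb: "b \<bullet> b = 1"
    using x p a2 b2 by (simp_all add: inner_vec_def power2_eq_square std_simplex_def)
  define \<theta> where "\<theta> = arccos (a \<bullet> b)"
  have ab: "(\<Sum>k\<in>UNIV. sqrt (x $ k * p $ k)) = a \<bullet> b"
    by (simp add: inner_vec_def a_def b_def real_sqrt_mult)
  have "\<bar>a \<bullet> b\<bar> \<le> 1"
    using Cauchy_Schwarz_ineq2[of a b] na nb by (simp add: norm_eq_sqrt_inner)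
  then have bounds: "-1 \<le> a \<bullet> b" "a \<bullet> b \<le> 1" by auto
  then have \<theta>0: "0 \<le> \<theta>" and cos: "cos \<theta> = a \<bullet> b"
    by (auto simp: \<theta>_def arccos_lbound)
  have "0 \<le> a \<bullet> b"
    using x p by (auto simp: ab[symmetric] std_simplex_def intro!: sum_nonneg)
  then have \<theta>le: "\<theta> \<le> pi / 2"
    using bounds unfolding \<theta>_def by (intro arccos_le_pi2) auto
  \<comment> \<open>Gram-Schmidt: \<open>e\<close> is the unit vector orthogonal to \<open>a\<close>
    in the plane of \<open>a\<close> and \<open>b\<close>. For \<theta> = 0 the two vectors coincide
    and \<open>e = 0\<close> serves.\<close>
  obtain e where e: "e \<bullet> e = 1 \<or> e = 0 \<and> \<theta> = 0" "a \<bullet> e = 0" "b = cos \<theta> *\<^sub>R a + sin \<theta> *\<^sub>R e"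
  proof (cases "\<theta> = 0")
    case True
    then have "(b - a) \<bullet> (b - a) = 0"
      using cos na nb by (simp add: inner_diff inner_commute)
    then show ?thesis using that[of 0] True by simp
  next
    case False
    have s: "sin \<theta> > 0" using False \<theta>0 \<theta>le by (intro sin_gt_zero) auto
    have "(b - cos \<theta> *\<^sub>R a) \<bullet> (b - cos \<theta> *\<^sub>R a) = (sin \<theta>)\<^sup>2"
      by (simp add: inner_diff na nb inner_commute[of b a] flip: cos)
         (simp add: sin_squared_eq flip: power2_eq_square)
    then have "((1 / sin \<theta>) *\<^sub>R (b - cos \<theta> *\<^sub>R a)) \<bullet> ((1 / sin \<theta>) *\<^sub>R (b - cos \<theta> *\<^sub>R a)) = 1"
      using s by (simp add: power2_eq_square)
    moreover have "a \<bullet> ((1 / sin \<theta>) *\<^sub>R (b - cos \<theta> *\<^sub>R a)) = 0"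
      by (simp add: inner_diff na cos)
    moreover have "b = cos \<theta> *\<^sub>R a + sin \<theta> *\<^sub>R ((1 / sin \<theta>) *\<^sub>R (b - cos \<theta> *\<^sub>R a))"
      using s by simp
    ultimately show ?thesis using that by blast
  qed
  have e1: "(sin (\<theta> * s))\<^sup>2 * (e \<bullet> e) = (sin (\<theta> * s))\<^sup>2" for s
    using e(1) by auto
  \<comment> \<open>The arc from \<open>a\<close> to \<open>b\<close>, run through on the unit
    interval with speed \<theta>; \<open>r'\<close> is its velocity.\<close>
  define r where "r = (\<lambda>s. cos (\<theta> * s) *\<^sub>R a + sin (\<theta> * s) *\<^sub>R e)"
  define r' where "r' = (\<lambda>s. \<theta> *\<^sub>R (cos (\<theta> * s) *\<^sub>R e - sin (\<theta> * s) *\<^sub>R a))"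
  define \<gamma> :: "real \<Rightarrow> real ^ 'n option" where "\<gamma> = (\<lambda>s. \<chi> k. (r s $ k)\<^sup>2)"
  define \<gamma>' :: "real \<Rightarrow> real ^ 'n option" where "\<gamma>' = (\<lambda>s. \<chi> k. 2 * r s $ k * r' s $ k)"
  have rr: "r s \<bullet> r s = 1" for s
  proof -
    have "r s \<bullet> r s = (cos (\<theta> * s))\<^sup>2 + (sin (\<theta> * s))\<^sup>2 * (e \<bullet> e)"
      by (simp add: r_def inner_add e na inner_commute[of e a] power2_eq_square)
    then show ?thesis by (simp add: e1)
  qed
  have rr': "r' s \<bullet> r' s \<le> \<theta>\<^sup>2" for s
  proof -
    have "r' s \<bullet> r' s = \<theta>\<^sup>2 * ((cos (\<theta> * s))\<^sup>2 * (e \<bullet> e) + (sin (\<theta> * s))\<^sup>2)"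
      by (simp add: r'_def e na inner_commute[of e a] power2_eq_square algebra_simps)
    also have "\<dots> \<le> \<theta>\<^sup>2 * 1"
      using e(1) by (intro mult_left_mono) auto
    finally show ?thesis by simp
  qed
  have der: "(\<gamma> has_vector_derivative \<gamma>' s) (at s)" for s
  proof -
    have "((\<lambda>s. (r s $ k)\<^sup>2) has_real_derivative 2 * r s $ k * r' s $ k) (at s)" for k
      unfolding r_def r'_def
      by (auto intro!: derivative_eq_intros simp: algebra_simps)
    then show ?thesis
      unfolding has_vector_derivative_def \<gamma>_def \<gamma>'_def
      by (subst has_derivative_componentwise_within)
        (auto simp: Basis_vec_def inner_axis has_field_derivative_def mult_commute_abs mult_ac)
  qed
  have cont: "continuous_on {0..1} \<gamma>'"
    unfolding \<gamma>'_def r_def r'_def by (intro continuous_intros)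
  have "\<gamma> piecewise_C1_differentiable_on {0..1}"
    using der cont unfolding C1_differentiable_on_def
    by (intro C1_differentiable_imp_piecewise) (auto simp: C1_differentiable_on_def)
  moreover have "path_image \<gamma> \<subseteq> std_simplex"
    using rr by (auto simp: path_image_def std_simplex_def \<gamma>_def inner_vec_def power2_eq_square)
  moreover have "pathstart \<gamma> = x"
    by (simp add: pathstart_def \<gamma>_def r_def vec_eq_iff a2)
  moreover have "pathfinish \<gamma> = p"
    using e(3) b2 by (simp add: pathfinish_def \<gamma>_def r_def vec_eq_iff)
  ultimately have "simplex_dist 4 x p \<le> simplex_length 4 \<gamma>"
    unfolding simplex_dist_def by (intro Inf_lower) auto
  also have "\<dots> \<le> (\<integral>\<^sup>+ s. ennreal \<theta> * indicator {0..1::real} s \<partial>lborel)"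
    unfolding simplex_length_def
  proof (intro nn_integral_mono mult_right_mono ennreal_leI)
    fix s :: real
    \<comment> \<open>Where \<open>r s $ k = 0\<close> the left side is \<open>0 / 0 = 0\<close>, so
      in general only an inequality holds.\<close>
    have "(\<gamma>' s $ k)\<^sup>2 / (4 * \<gamma> s $ k) \<le> (r' s $ k)\<^sup>2" for k
      by (cases "r s $ k = 0") (auto simp: \<gamma>_def \<gamma>'_def power_mult_distrib)
    then have "(\<Sum>k\<in>UNIV. (\<gamma>' s $ k)\<^sup>2 / (4 * \<gamma> s $ k)) \<le> (\<Sum>k\<in>UNIV. (r' s $ k)\<^sup>2)"
      by (intro sum_mono) auto
    also have "\<dots> \<le> \<theta>\<^sup>2"
      using rr'[of s] by (simp add: inner_vec_def power2_eq_square)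
    finally show "sqrt (\<Sum>k\<in>UNIV. (vector_derivative \<gamma> (at s) $ k)\<^sup>2 / (4 * \<gamma> s $ k)) \<le> \<theta>"
      unfolding vector_derivative_at[OF der] using \<theta>0 by (simp add: real_le_lsqrt)
  qed auto
  also have "\<dots> = ennreal \<theta>"
    by (simp add: nn_integral_cmult)
  finally show ?thesis
    by (simp add: \<theta>_def ab)
qed

section \<open>Moments of the uniform measure on the simplex\<close>

lemma nn_integral_dirichlet_lborel:
  fixes a :: "'n::finite \<Rightarrow> nat"
  shows "(\<integral>\<^sup>+ y. ennreal (if (\<forall>i. 0 \<le> y $ i) \<and> (\<Sum>i\<in>UNIV. y $ i) \<le> 1
      then (\<Prod>i\<in>UNIV. y $ i ^ a i) * (1 - (\<Sum>i\<in>UNIV. y $ i)) ^ m else 0) \<partial>lborel) =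
    ennreal ((\<Prod>i\<in>UNIV. fact (a i)) * fact m / fact (CARD('n) + sum a UNIV + m))"
proof -
  \<comment> \<open>Lebesgue measure is built as a product over basis vectors, so the exponents are
    moved from indices to basis vectors.\<close>
  define a' :: "real ^ 'n \<Rightarrow> nat" where "a' = (\<lambda>b. a (the_inv (\<lambda>i. axis i 1) b))"
  have inj: "inj (\<lambda>i::'n. axis i (1::real))"
    by (auto simp: inj_on_def axis_eq_axis)
  have Basis: "(Basis :: (real ^ 'n) set) = range (\<lambda>i. axis i 1)"
    by (auto simp: Basis_vec_def)
  have a': "a' (axis i 1) = a i" for i
    by (simp add: a'_def the_inv_f_f[OF inj])
  have nth: "(\<Sum>b\<in>Basis. f b *\<^sub>R b) $ i = f (axis i 1)" for f :: "real ^ 'n \<Rightarrow> real" and i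
  proof -
    have "(\<Sum>b\<in>Basis. f b *\<^sub>R b) $ i = (\<Sum>b\<in>Basis. f b *\<^sub>R b) \<bullet> axis i 1"
      by (simp add: inner_axis)
    also have "\<dots> = f (axis i 1)"
      by (rule inner_sum_left_Basis) (simp add: Basis)
    finally show ?thesis .
  qed
  have eq: "(if (\<forall>i. 0 \<le> y $ i) \<and> (\<Sum>i\<in>UNIV. y $ i) \<le> 1
        then (\<Prod>i\<in>UNIV. y $ i ^ a i) * (1 - (\<Sum>i\<in>UNIV. y $ i)) ^ m else 0) =
      (if (\<forall>b\<in>Basis. 0 \<le> f b) \<and> sum f Basis \<le> 1
        then (\<Prod>b\<in>Basis. f b ^ a' b) * (1 - sum f Basis) ^ m else 0)"
    if "y = (\<Sum>b\<in>Basis. f b *\<^sub>R b)" for y :: "real ^ 'n" and f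
    unfolding that nth unfolding Basis using inj by (simp add: sum.reindex prod.reindex a')
  have "(\<integral>\<^sup>+ y. ennreal (if (\<forall>i. 0 \<le> y $ i) \<and> (\<Sum>i\<in>UNIV. y $ i) \<le> 1
      then (\<Prod>i\<in>UNIV. y $ i ^ a i) * (1 - (\<Sum>i\<in>UNIV. y $ i)) ^ m else 0) \<partial>(lborel :: (real ^ 'n) measure)) =
    (\<integral>\<^sup>+ f. ennreal (if (\<forall>b\<in>Basis. 0 \<le> f b) \<and> sum f Basis \<le> 1
        then (\<Prod>b\<in>Basis. f b ^ a' b) * (1 - sum f Basis) ^ m else 0)
      \<partial>PiM (Basis :: (real ^ 'n) set) (\<lambda>_. lborel))"
    unfolding lborel_eq[where 'a = "real ^ 'n"]
    by (subst nn_integral_distr, measurable) (simp only: eq[OF refl])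
  also have "\<dots> = ennreal ((\<Prod>b\<in>(Basis :: (real ^ 'n) set). fact (a' b)) * fact m / fact (card (Basis :: (real ^ 'n) set) + sum a' Basis + m))"
    by (rule nn_integral_dirichlet_PiM) simp
  also have "card (Basis :: (real ^ 'n) set) = CARD('n)"
    by simp
  also have "sum a' Basis = sum a UNIV"
    using inj by (simp add: Basis sum.reindex a')
  also have "(\<Prod>b\<in>(Basis :: (real ^ 'n) set). fact (a' b)) = (\<Prod>i\<in>UNIV. fact (a i) :: real)"
    using inj by (simp add: Basis prod.reindex a')
  finally show ?thesis .
qed

lemma sum_option: "(\<Sum>k\<in>(UNIV :: 'n::finite option set). f k) = f None + (\<Sum>i\<in>UNIV. f (Some i))"
  by (simp add: UNIV_option_conv sum.reindex)

lemma prod_option: "(\<Prod>k\<in>(UNIV :: 'n::finite option set). f k) = f None * (\<Prod>i\<in>UNIV. f (Some i))"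
  by (simp add: UNIV_option_conv prod.reindex)

lemma barycentric_in_simplex_iff:
  "barycentric y \<in> std_simplex \<longleftrightarrow> (\<forall>i. 0 \<le> y $ i) \<and> (\<Sum>i\<in>UNIV. y $ i) \<le> 1"
  by (auto simp: std_simplex_def barycentric_def split_option_all sum_option)

lemma borel_measurable_barycentric [measurable]: "barycentric \<in> borel_measurable borel"
proof -
  have "continuous_on UNIV (\<lambda>y :: real ^ 'n. case k of None \<Rightarrow> 1 - (\<Sum>i\<in>UNIV. y $ i) | Some i \<Rightarrow> y $ i)" for k
    by (cases k) (auto intro!: continuous_on_diff continuous_on_sum continuous_on_component)
  then have "continuous_on UNIV (barycentric :: real ^ 'n \<Rightarrow> real ^ 'n option)"
    unfolding barycentric_def by (rule continuous_on_vec_lambda)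
  then show ?thesis by (rule borel_measurable_continuous_onI)
qed

text \<open>In the chart this is a Dirichlet integral whose \<open>m\<close> is the exponent at
  \<open>None\<close>. The constant monomial gives the volume \<open>1 / fact CARD('n)\<close>, and
  normalization puts its inverse in front.\<close>

lemma has_bochner_integral_simplex_monomial:
  fixes \<alpha> :: "'n::finite option \<Rightarrow> nat"
  shows "has_bochner_integral simplex_measure (\<lambda>x. \<Prod>k\<in>UNIV. x $ k ^ \<alpha> k)
    (fact CARD('n) * (\<Prod>k\<in>UNIV. fact (\<alpha> k)) / fact (CARD('n) + (\<Sum>k\<in>UNIV. \<alpha> k)))"
proof -
  define S where "S = {y :: real ^ 'n. barycentric y \<in> std_simplex}"
  have S: "S = {y. (\<forall>i. 0 \<le> y $ i) \<and> (\<Sum>i\<in>UNIV. y $ i) \<le> 1}"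
    by (simp add: S_def barycentric_in_simplex_iff)
  have [measurable]: "S \<in> sets borel"
    unfolding S by measurable
  have dir: "(\<integral>\<^sup>+ y. ennreal (\<Prod>k\<in>UNIV. barycentric y $ k ^ \<beta> k) * indicator S y \<partial>lborel) =
      ennreal ((\<Prod>k\<in>UNIV. fact (\<beta> k)) / fact (CARD('n) + (\<Sum>k\<in>UNIV. \<beta> k)))" for \<beta> :: "'n option \<Rightarrow> nat"
  proof -
    have "(\<integral>\<^sup>+ y. ennreal (\<Prod>k\<in>UNIV. barycentric y $ k ^ \<beta> k) * indicator S y \<partial>lborel) =
      (\<integral>\<^sup>+ y. ennreal (if (\<forall>i. 0 \<le> y $ i) \<and> (\<Sum>i\<in>UNIV. y $ i) \<le> 1
      then (\<Prod>i\<in>UNIV. y $ i ^ \<beta> (Some i)) * (1 - (\<Sum>i\<in>UNIV. y $ i)) ^ \<beta> None else 0) \<partial>(lborel :: (real ^ 'n) measure))"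
      by (intro nn_integral_cong) (auto simp: S barycentric_def prod_option mult.commute)
    also have "\<dots> = ennreal ((\<Prod>k\<in>UNIV. fact (\<beta> k)) / fact (CARD('n) + (\<Sum>k\<in>UNIV. \<beta> k)))"
      unfolding nn_integral_dirichlet_lborel by (simp add: prod_option sum_option mult_ac add_ac)
    finally show ?thesis .
  qed
  have vol: "emeasure lborel S = ennreal (1 / fact CARD('n))"
    using dir[of "\<lambda>_. 0"] by simp
  define \<mu> where "\<mu> = uniform_measure lborel S"
  have sm: "simplex_measure = distr \<mu> borel barycentric"
    by (simp add: simplex_measure_def \<mu>_def S_def)
  have [measurable]: "barycentric \<in> measurable \<mu> borel"
    by (simp add: \<mu>_def)
  have [measurable]: "(\<lambda>y. barycentric y $ k) \<in> borel_measurable (lborel :: (real ^ 'n) measure)" for k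
    using measurable_compose[OF borel_measurable_barycentric borel_measurable_nth] by simp
  have "(\<integral>\<^sup>+ x. ennreal (\<Prod>k\<in>UNIV. x $ k ^ \<alpha> k) \<partial>simplex_measure) =
      (\<integral>\<^sup>+ y. ennreal (\<Prod>k\<in>UNIV. barycentric y $ k ^ \<alpha> k) \<partial>\<mu>)"
    unfolding sm by (subst nn_integral_distr) auto
  also have "\<dots> = (\<integral>\<^sup>+ y. ennreal (\<Prod>k\<in>UNIV. barycentric y $ k ^ \<alpha> k) * indicator S y \<partial>lborel) / emeasure lborel S"
    unfolding \<mu>_def by (subst nn_integral_uniform_measure) auto
  also have "\<dots> = ennreal (fact CARD('n) * (\<Prod>k\<in>UNIV. fact (\<alpha> k)) / fact (CARD('n) + (\<Sum>k\<in>UNIV. \<alpha> k)))"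
    unfolding dir vol by (subst divide_ennreal) (auto intro!: divide_nonneg_nonneg prod_nonneg simp: mult_ac)
  finally have "(\<integral>\<^sup>+ x. ennreal (\<Prod>k\<in>UNIV. x $ k ^ \<alpha> k) \<partial>simplex_measure) =
      ennreal (fact CARD('n) * (\<Prod>k\<in>UNIV. fact (\<alpha> k)) / fact (CARD('n) + (\<Sum>k\<in>UNIV. \<alpha> k)))" .
  \<comment> \<open>A monomial may be negative off the simplex, but the measure is concentrated on
    it.\<close>
  moreover have "AE x in simplex_measure. 0 \<le> (\<Prod>k\<in>UNIV. x $ k ^ \<alpha> k)"
  proof -
    have "AE y in \<mu>. y \<in> S"
      unfolding \<mu>_def by (rule AE_uniform_measureI) auto
    then have "AE y in \<mu>. 0 \<le> (\<Prod>k\<in>UNIV. barycentric y $ k ^ \<alpha> k)"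
      by eventually_elim (auto simp: S_def std_simplex_def intro!: prod_nonneg)
    then show ?thesis
      unfolding sm by (subst AE_distr_iff) auto
  qed
  moreover have "(\<lambda>x. \<Prod>k\<in>UNIV. x $ k ^ \<alpha> k) \<in> borel_measurable simplex_measure"
    unfolding sm by simp
  ultimately show ?thesis
    by (intro has_bochner_integral_nn_integral) (auto intro!: divide_nonneg_nonneg mult_nonneg_nonneg prod_nonneg)
qed

section \<open>Integrals for the Jacobi weight on [-1, 1]\<close>

lemma poly_eq_sum_bounded:
  fixes h :: "real poly"
  assumes "degree h \<le> d"
  shows "poly h s = (\<Sum>m\<le>d. coeff h m * s ^ m)"
  unfolding poly_altdef using assms by (intro sum.mono_neutral_left) (auto simp: coeff_eq_0)

text \<open>Expand \<open>g\<close> in powers of \<open>s = (u + 1) / 2\<close>; each power times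
  the weight is a beta integral over an interval of length 2. The composed polynomial
  \<open>g (2 s - 1)\<close> is the one that the zonal average expands, so the two sides can be
  compared coefficient by coefficient.\<close>

lemma has_integral_jacobi_weight:
  fixes g :: "real poly"
  assumes "degree g \<le> d"
  shows "((\<lambda>u. poly g u * (1 - u) ^ n) has_integral
    2 ^ Suc n * (\<Sum>m\<le>d. coeff (pcompose g [:-1, 2:]) m * (fact m * fact n / fact (m + n + 1)))) {-1..1}"
proof -
  let ?h = "pcompose g [:-1, 2:]"
  have h: "poly g u = (\<Sum>m\<le>d. coeff ?h m * ((u + 1) / 2) ^ m)" for u
  proof -
    have "degree ?h \<le> d"
      using assms by (simp add: degree_pcompose)
    from poly_eq_sum_bounded[OF this, of "(u + 1) / 2"] show ?thesis
      by (simp add: poly_pcompose field_simps)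
  qed
  have "((\<lambda>u. \<Sum>m\<le>d. coeff ?h m / 2 ^ m * ((u - (-1)) ^ m * (1 - u) ^ n)) has_integral
      (\<Sum>m\<le>d. coeff ?h m / 2 ^ m * (fact m * fact n / fact (m + n + 1) * (1 - (-1)) ^ (m + n + 1)))) {-1..1}"
    by (intro has_integral_sum has_integral_mult_right has_integral_beta_powers) auto
  moreover have "(\<Sum>m\<le>d. coeff ?h m / 2 ^ m * ((u - (-1)) ^ m * (1 - u) ^ n)) = poly g u * (1 - u) ^ n" for u
    unfolding h sum_distrib_right by (simp add: power_divide mult.assoc)
  moreover have "(\<Sum>m\<le>d. coeff ?h m / 2 ^ m * (fact m * fact n / fact (m + n + 1) * (1 - (-1)) ^ (m + n + 1))) =
      2 ^ Suc n * (\<Sum>m\<le>d. coeff ?h m * (fact m * fact n / fact (m + n + 1)))"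
    unfolding sum_distrib_left
    by (intro sum.cong refl) (simp add: power_add del: fact_Suc)
  ultimately show ?thesis by simp
qed

text \<open>Real and natural powers agree inside the interval. At the end points they may differ
  because \<open>0 powr 0 = 0\<close>, but these form a null set.\<close>

lemma set_lebesgue_integral_jacobi_weight:
  fixes g :: "real poly"
  assumes "0 < n"
  shows "(LBINT u:{-1..1}. poly g u * ((1 - u) powr (real n - 1) * (1 + u) powr 0)) =
    integral {-1..1} (\<lambda>u. poly g u * (1 - u) ^ (n - 1))"
proof -
  have cont: "continuous_on S (poly g)" for S
    by (intro continuous_intros)
  have [measurable]: "poly g \<in> borel_measurable borel"
    by (intro borel_measurable_continuous_onI cont)
  have AE: "AE u in lborel. u \<noteq> (1::real)" "AE u in lborel. u \<noteq> (-1::real)"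
    by (rule AE_lborel_singleton)+
  have "(LBINT u:{-1..1}. poly g u * ((1 - u) powr (real n - 1) * (1 + u) powr 0)) =
      (LBINT u:{-1..1}. poly g u * (1 - u) ^ (n - 1))"
  proof (rule set_lebesgue_integral_cong_AE)
    show "AE u\<in>{-1..1} in lborel. poly g u * ((1 - u) powr (real n - 1) * (1 + u) powr 0) = poly g u * (1 - u) ^ (n - 1)"
      using AE
    proof eventually_elim
      case (elim u)
      show ?case
      proof
        assume "u \<in> {-1..1}"
        then have "0 < 1 - u" "0 < 1 + u" using elim by auto
        then show "poly g u * ((1 - u) powr (real n - 1) * (1 + u) powr 0) = poly g u * (1 - u) ^ (n - 1)"
          using powr_realpow[of "1 - u" "n - 1"] assms by simp
      qed
    qed
  qed measurable
  also have "\<dots> = integral {-1..1} (\<lambda>u. poly g u * (1 - u) ^ (n - 1))"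
    by (intro set_borel_integral_eq_integral borel_integrable_atLeastAtMost' continuous_intros)
  finally show ?thesis .
qed

section \<open>Zonal averages and cubature\<close>

text \<open>
  Phases restricted to \<open>N\<close>-th roots of unity with \<open>N > degree g\<close> give the same average as the full
  torus, and a finite sum.
\<close>

definition zonal_average :: "nat \<Rightarrow> real poly \<Rightarrow> real ^ ('k::finite) \<Rightarrow> real ^ 'k \<Rightarrow> real" where
  "zonal_average N g x p = (\<Sum>\<theta>\<in>(UNIV \<rightarrow>\<^sub>E {..<N}).
     poly g (2 * (cmod (torus_sum N (\<lambda>k. sqrt (x $ k * p $ k)) \<theta>))\<^sup>2 - 1)) / real N ^ CARD('k)"

text \<open>Average each power of \<open>s\<close> in \<open>g (2 s - 1)\<close> separately, then
  collect the multi-indices of all total degrees up to \<open>d\<close>. The squared radii are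
  \<open>x $ k * p $ k\<close> for nonnegative coordinates, so on the orthant the average is a
  polynomial in \<open>p\<close> of degree at most \<open>d\<close>.\<close>

lemma zonal_average_eq_polynomial:
  fixes x p :: "real ^ 'k::finite"
  assumes "degree g \<le> d" "d < N" and x: "\<And>k. 0 \<le> x $ k" and p: "\<And>k. 0 \<le> p $ k"
  shows "zonal_average N g x p = (\<Sum>\<alpha> | (\<Sum>k\<in>UNIV. \<alpha> k) \<le> d.
    coeff (pcompose g [:-1, 2:]) (\<Sum>k\<in>UNIV. \<alpha> k) * ((multinomial_coeff \<alpha>)\<^sup>2 * (\<Prod>k\<in>UNIV. x $ k ^ \<alpha> k)) *
      (\<Prod>k\<in>UNIV. p $ k ^ \<alpha> k))" (is "_ = sum ?f _")
proof -
  let ?h = "pcompose g [:-1, 2:]"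
  let ?r = "\<lambda>k. sqrt (x $ k * p $ k)"
  have "degree ?h \<le> d"
    using assms(1) by (simp add: degree_pcompose)
  from poly_eq_sum_bounded[OF this]
  have h: "poly g (2 * s - 1) = (\<Sum>m\<le>d. coeff ?h m * s ^ m)" for s
    by (simp add: poly_pcompose mult.commute)
  have "zonal_average N g x p = (\<Sum>m\<le>d. coeff ?h m *
      ((\<Sum>\<theta>\<in>(UNIV \<rightarrow>\<^sub>E {..<N}). (cmod (torus_sum N ?r \<theta>))\<^sup>2 ^ m) / real N ^ CARD('k)))"
    unfolding zonal_average_def h
    by (subst sum.swap) (simp only: sum_divide_distrib sum_distrib_left times_divide_eq_right)
  also have "\<dots> = (\<Sum>m\<le>d. \<Sum>\<alpha> | (\<Sum>k\<in>UNIV. \<alpha> k) = m. ?f \<alpha>)"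
  proof (rule sum.cong[OF refl])
    fix m assume "m \<in> {..d}"
    then have "m < N" using assms by simp
    have "coeff ?h m * ((\<Sum>\<theta>\<in>(UNIV \<rightarrow>\<^sub>E {..<N}). (cmod (torus_sum N ?r \<theta>))\<^sup>2 ^ m) / real N ^ CARD('k)) =
        (\<Sum>\<alpha> | (\<Sum>k\<in>UNIV. \<alpha> k) = m. coeff ?h m * ((multinomial_coeff \<alpha>)\<^sup>2 * (\<Prod>k\<in>UNIV. ((?r k)\<^sup>2) ^ \<alpha> k)))"
      unfolding torus_average_power[OF \<open>m < N\<close>] sum_distrib_left ..
    also have "\<dots> = (\<Sum>\<alpha> | (\<Sum>k\<in>UNIV. \<alpha> k) = m. ?f \<alpha>)"
      using x p by (intro sum.cong refl) (simp add: power_mult_distrib prod.distrib)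
    finally show "coeff ?h m * ((\<Sum>\<theta>\<in>(UNIV \<rightarrow>\<^sub>E {..<N}). (cmod (torus_sum N ?r \<theta>))\<^sup>2 ^ m) / real N ^ CARD('k)) =
        (\<Sum>\<alpha> | (\<Sum>k\<in>UNIV. \<alpha> k) = m. ?f \<alpha>)" .
  qed
  also have "\<dots> = (\<Sum>m\<le>d. \<Sum>\<alpha>\<in>{\<alpha> \<in> {\<alpha>. (\<Sum>k\<in>UNIV. \<alpha> k) \<le> d}. (\<Sum>k\<in>UNIV. \<alpha> k) = m}. ?f \<alpha>)"
    by (intro sum.cong refl) auto
  also have "\<dots> = (\<Sum>\<alpha> | (\<Sum>k\<in>UNIV. \<alpha> k) \<le> d. ?f \<alpha>)"
    by (intro sum.group finite_multi_indices_le) auto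
  finally show ?thesis .
qed

text \<open>The mean over the simplex is independent of \<open>x\<close>: the moment of each
  monomial cancels one of its two multinomial coefficients, and what remains in total degree
  \<open>m\<close> sums to the \<open>m\<close>-th power of the coordinate sum of \<open>x\<close>,
  which is 1. The numbers left over are the moments of \<open>(1 - u) ^ (n - 1)\<close> on [-1, 1],
  normalized to mass 1 by \<open>n / 2 ^ n\<close>, where \<open>n = CARD('n)\<close>.\<close>

lemma cubature_zonal_average:
  fixes F :: "(real ^ ('n::finite option)) set"
  assumes cub: "cubature_formula d F w" and F: "F \<subseteq> std_simplex" and x: "x \<in> std_simplex"
    and deg: "degree g \<le> d" and N: "d < N"
  shows "(\<Sum>p\<in>F. w p * zonal_average N g x p) =
    real CARD('n) / 2 ^ CARD('n) * integral {-1..1} (\<lambda>u. poly g u * (1 - u) ^ (CARD('n) - 1))"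
proof -
  let ?n = "CARD('n)"
  let ?A = "{\<alpha> :: 'n option \<Rightarrow> nat. (\<Sum>k\<in>UNIV. \<alpha> k) \<le> d}"
  let ?h = "pcompose g [:-1, 2:]"
  define c where "c = (\<lambda>\<alpha>. coeff ?h (\<Sum>k\<in>UNIV. \<alpha> k) * ((multinomial_coeff \<alpha>)\<^sup>2 * (\<Prod>k\<in>UNIV. x $ k ^ \<alpha> k)))"
  \<comment> \<open>The cubature formula is applied to this polynomial, which equals the average at
    the points of \<open>F\<close>.\<close>
  define P where "P = (\<lambda>p. \<Sum>\<alpha>\<in>?A. c \<alpha> * (\<Prod>k\<in>UNIV. p $ k ^ \<alpha> k))"
  have n: "0 < ?n" by simp
  have x0: "0 \<le> x $ k" and x1: "(\<Sum>k\<in>UNIV. x $ k) = 1" for k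
    using x by (auto simp: std_simplex_def)
  have "zonal_average N g x p = P p" if "p \<in> F" for p
    using that F deg N x0 unfolding P_def c_def
    by (intro zonal_average_eq_polynomial) (auto simp: std_simplex_def)
  then have "(\<Sum>p\<in>F. w p * zonal_average N g x p) = (\<Sum>p\<in>F. w p * P p)"
    by simp
  also have "\<dots> = (\<integral>p. P p \<partial>simplex_measure)"
  proof -
    have "P \<in> polynomials_upto d"
      unfolding polynomials_upto_def P_def by blast
    then show ?thesis
      using cub by (simp add: cubature_formula_def)
  qed
  also have "\<dots> = (\<Sum>\<alpha>\<in>?A. c \<alpha> * (fact ?n * (\<Prod>k\<in>UNIV. fact (\<alpha> k)) / fact (?n + (\<Sum>k\<in>UNIV. \<alpha> k))))"
    unfolding P_def
    by (intro has_bochner_integral_integral_eq has_bochner_integral_sum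
        has_bochner_integral_mult_right has_bochner_integral_simplex_monomial)
  also have "\<dots> = (\<Sum>\<alpha>\<in>?A. coeff ?h (\<Sum>k\<in>UNIV. \<alpha> k) * (fact ?n * fact (\<Sum>k\<in>UNIV. \<alpha> k) / fact (?n + (\<Sum>k\<in>UNIV. \<alpha> k))) *
      (multinomial_coeff \<alpha> * (\<Prod>k\<in>UNIV. x $ k ^ \<alpha> k)))" (is "_ = sum ?f _")
  proof (rule sum.cong[OF refl])
    fix \<alpha> :: "'n option \<Rightarrow> nat"
    have "(\<Prod>k\<in>UNIV. fact (\<alpha> k)) \<noteq> (0::real)"
      by simp
    then have "(multinomial_coeff \<alpha>)\<^sup>2 * (\<Prod>k\<in>UNIV. fact (\<alpha> k)) = multinomial_coeff \<alpha> * fact (\<Sum>k\<in>UNIV. \<alpha> k)"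
      by (simp add: multinomial_coeff_def power2_eq_square)
    moreover have "h * (mm * y) * (f * q / e) = h * (f * s / e) * (l * y)"
      if "mm * q = l * s" for h mm y f q e s l :: real
    proof -
      have "h * (mm * y) * (f * q / e) = h * y * f / e * (mm * q)" by simp
      then show ?thesis using that by simp
    qed
    ultimately show "c \<alpha> * (fact ?n * (\<Prod>k\<in>UNIV. fact (\<alpha> k)) / fact (?n + (\<Sum>k\<in>UNIV. \<alpha> k))) = ?f \<alpha>"
      unfolding c_def by blast
  qed
  also have "\<dots> = (\<Sum>m\<le>d. \<Sum>\<alpha>\<in>{\<alpha> \<in> ?A. (\<Sum>k\<in>UNIV. \<alpha> k) = m}. ?f \<alpha>)"
    by (intro sum.group[symmetric] finite_multi_indices_le) auto
  also have "\<dots> = (\<Sum>m\<le>d. coeff ?h m * (fact ?n * fact m / fact (?n + m)))"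
  proof (rule sum.cong[OF refl])
    fix m assume "m \<in> {..d}"
    then have A: "{\<alpha> \<in> ?A. (\<Sum>k\<in>UNIV. \<alpha> k) = m} = {\<alpha>. (\<Sum>k\<in>UNIV. \<alpha> k) = m}"
      by auto
    have "(\<Sum>\<alpha> | (\<Sum>k\<in>UNIV. \<alpha> k) = m. ?f \<alpha>) = coeff ?h m * (fact ?n * fact m / fact (?n + m)) *
        (\<Sum>\<alpha> | (\<Sum>k\<in>UNIV. \<alpha> k) = m. multinomial_coeff \<alpha> * (\<Prod>k\<in>UNIV. x $ k ^ \<alpha> k))"
      unfolding sum_distrib_left by (intro sum.cong refl) auto
    also have "(\<Sum>\<alpha> | (\<Sum>k\<in>UNIV. \<alpha> k) = m. multinomial_coeff \<alpha> * (\<Prod>k\<in>UNIV. x $ k ^ \<alpha> k)) = 1"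
      using multinomial_theorem[of "\<lambda>k. x $ k" m] by (simp add: x1)
    finally show "(\<Sum>\<alpha>\<in>{\<alpha> \<in> ?A. (\<Sum>k\<in>UNIV. \<alpha> k) = m}. ?f \<alpha>) = coeff ?h m * (fact ?n * fact m / fact (?n + m))"
      unfolding A by simp
  qed
  also have "\<dots> = real ?n / 2 ^ ?n * (2 ^ Suc (?n - 1) * (\<Sum>m\<le>d. coeff ?h m * (fact m * fact (?n - 1) / fact (m + (?n - 1) + 1))))"
  proof -
    have "real ?n / 2 ^ ?n * (2 ^ Suc (?n - 1) * X) = real ?n * X" for X
      using n by simp
    moreover have "fact ?n * fact m / fact (?n + m) = real ?n * (fact m * fact (?n - 1) / fact (m + (?n - 1) + 1))" for m
    proof -
      have "fact ?n = real ?n * fact (?n - 1)" by (rule fact_reduce) (rule n)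
      moreover have "m + (?n - 1) + 1 = ?n + m" using n by simp
      ultimately show ?thesis by (simp add: mult_ac add.commute)
    qed
    ultimately show ?thesis
      by (simp only: sum_distrib_left) (simp only: mult_ac)
  qed
  also have "\<dots> = real ?n / 2 ^ ?n * integral {-1..1} (\<lambda>u. poly g u * (1 - u) ^ (?n - 1))"
    using integral_unique[OF has_integral_jacobi_weight[OF deg, of "?n - 1"]] by simp
  finally show ?thesis .
qed

section \<open>The covering argument\<close>

text \<open>A continuous nonnegative function with integral 0 vanishes, and the weight is positive
  on the open interval, so a nonzero \<open>q\<close> would have infinitely many roots.\<close>

lemma integral_square_jacobi_weight_eq_0:
  fixes q :: "real poly"
  assumes "integral {-1..1} (\<lambda>u. poly (q * q) u * (1 - u) ^ n) = 0"
  shows "q = 0"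
proof (rule ccontr)
  assume "q \<noteq> 0"
  have cont: "continuous_on {-1..1} (\<lambda>u. poly (q * q) u * (1 - u) ^ n)"
    by (intro continuous_intros)
  have int: "((\<lambda>u. poly (q * q) u * (1 - u) ^ n) has_integral 0) (cbox (-1) 1)"
    using integrable_integral[OF integrable_continuous_real[OF cont]] assms by simp
  have "{-1<..<1} \<subseteq> {u. poly q u = 0}"
  proof
    fix u :: real assume u: "u \<in> {-1<..<1}"
    have "poly (q * q) u * (1 - u) ^ n = 0"
      by (rule has_integral_0_cbox_imp_0[OF _ _ int]) (use cont u in auto)
    then show "u \<in> {u. poly q u = 0}" using u by simp
  qed
  then have "finite {-1<..<1::real}"
    using poly_roots_finite[OF \<open>q \<noteq> 0\<close>] finite_subset by blast
  then show False
    using infinite_Ioo[of "-1::real" 1] by simp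
qed

text \<open>Every zero of \<open>J\<close> yields such a point; the highest one gives the strongest
  bound.\<close>

lemma cubature_point_near:
  fixes F :: "(real ^ ('n::finite option)) set"
  assumes t: "1 \<le> t" and cub: "cubature_formula (2 * t - 1) F w" and pos: "positive_weights F w"
    and F: "F \<subseteq> std_simplex" and x: "x \<in> std_simplex"
    and jac: "jacobi_polynomial (real CARD('n) - 1) 0 t J" and z: "poly J z = 0"
  shows "\<exists>p\<in>F. z \<le> 2 * (\<Sum>k\<in>UNIV. sqrt (x $ k * p $ k))\<^sup>2 - 1"
proof (rule ccontr)
  assume "\<not> ?thesis"
  then have far: "2 * (\<Sum>k\<in>UNIV. sqrt (x $ k * p $ k))\<^sup>2 - 1 < z" if "p \<in> F" for p
    using that by force
  let ?n = "CARD('n)"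
  \<comment> \<open>The least number of phases exceeding the degree \<open>2 * t - 1\<close> of the
    cubature formula.\<close>
  define N where "N = 2 * t"
  have N: "2 * t - 1 < N" "0 < N" using t by (auto simp: N_def)
  obtain q where J: "J = [:-z, 1:] * q"
    using z by (auto simp: poly_eq_0_iff_dvd dvd_def)
  have "J \<noteq> 0" "degree J = t"
    using jac by (auto simp: jacobi_polynomial_def)
  then have q0: "q \<noteq> 0" and degq: "degree q = t - 1"
    unfolding J by (auto simp: degree_mult_eq simp del: mult_pCons_left)
  define u where "u = (\<lambda>p \<theta>. 2 * (cmod (torus_sum N (\<lambda>k. sqrt (x $ k * p $ k)) \<theta>))\<^sup>2 - 1)"
  have u: "u p \<theta> < z" if "p \<in> F" for p \<theta>
  proof -
    have "cmod (torus_sum N (\<lambda>k. sqrt (x $ k * p $ k)) \<theta>) \<le> (\<Sum>k\<in>UNIV. sqrt (x $ k * p $ k))"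
      using that F x by (intro cmod_torus_sum_le) (auto simp: std_simplex_def)
    then have "(cmod (torus_sum N (\<lambda>k. sqrt (x $ k * p $ k)) \<theta>))\<^sup>2 \<le> (\<Sum>k\<in>UNIV. sqrt (x $ k * p $ k))\<^sup>2"
      by (rule power_mono) simp
    then show ?thesis using far[OF that] by (simp add: u_def)
  qed
  have avg: "zonal_average N g x p = (\<Sum>\<theta>\<in>(UNIV \<rightarrow>\<^sub>E {..<N}). poly g (u p \<theta>)) / real N ^ CARD('n option)" for g p
    by (simp add: zonal_average_def u_def)
  have fin: "finite ((UNIV :: 'n option set) \<rightarrow>\<^sub>E {..<N})"
    by (intro finite_PiE) auto
  \<comment> \<open>Its degree \<open>1 + 2 * (t - 1)\<close> is the highest that the formula
    integrates exactly, and it is nonpositive to the left of \<open>z\<close>.\<close>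
  let ?g = "[:-z, 1:] * q * q"
  have degg: "degree ?g \<le> 2 * t - 1"
    using q0 degq t by (subst degree_mult_eq | simp del: mult_pCons_left)+
  have gneg: "poly ?g (u p \<theta>) \<le> 0" if "p \<in> F" for p \<theta>
    using u[OF that, of \<theta>] by (auto simp: mult_le_0_iff mult.assoc simp del: mult_pCons_left)
  \<comment> \<open>Orthogonality applies because \<open>q\<close> has degree
    \<open>t - 1\<close>.\<close>
  have "(LBINT u:{-1..1}. poly J u * poly q u * ((1 - u) powr (real ?n - 1) * (1 + u) powr 0)) = 0"
    using jac degq t unfolding jacobi_polynomial_def by auto
  then have "integral {-1..1} (\<lambda>u. poly ?g u * (1 - u) ^ (?n - 1)) = 0"
    using set_lebesgue_integral_jacobi_weight[of ?n ?g] by (simp add: J mult.assoc del: mult_pCons_left)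
  then have "(\<Sum>p\<in>F. w p * zonal_average N ?g x p) = 0"
    using cubature_zonal_average[OF cub F x degg N(1)] by (simp del: mult_pCons_left)
  moreover have "finite F" using cub by (simp add: cubature_formula_def)
  moreover have neg: "w p * zonal_average N ?g x p \<le> 0" if "p \<in> F" for p
    unfolding avg using that pos
    by (intro mult_nonneg_nonpos divide_nonpos_nonneg sum_nonpos gneg) (auto simp: positive_weights_def intro: less_imp_le)
  ultimately have "w p * zonal_average N ?g x p = 0" if "p \<in> F" for p
    using that sum_nonneg_0[of F "\<lambda>p. - (w p * zonal_average N ?g x p)" p]
    by (simp add: sum_negf del: mult_pCons_left)
  then have "(\<Sum>\<theta>\<in>(UNIV \<rightarrow>\<^sub>E {..<N}). poly ?g (u p \<theta>)) = 0" if "p \<in> F" for p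
    using that pos N by (force simp: avg positive_weights_def simp del: mult_pCons_left)
  then have "poly ?g (u p \<theta>) = 0" if "p \<in> F" "\<theta> \<in> UNIV \<rightarrow>\<^sub>E {..<N}" for p \<theta>
    using that sum_nonneg_0[OF fin, of "\<lambda>\<theta>. - poly ?g (u p \<theta>)" \<theta>] gneg
    by (simp add: sum_negf del: mult_pCons_left)
  \<comment> \<open>The linear factor is nonzero here, since \<open>u p\<close> stays strictly below
    \<open>z\<close>.\<close>
  then have "poly q (u p \<theta>) = 0" if "p \<in> F" "\<theta> \<in> UNIV \<rightarrow>\<^sub>E {..<N}" for p \<theta>
    using that u[of p \<theta>] by force
  then have "zonal_average N (q * q) x p = 0" if "p \<in> F" for p
    unfolding avg using that by simp
  then have "(\<Sum>p\<in>F. w p * zonal_average N (q * q) x p) = 0"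
    by simp
  moreover have "degree (q * q) \<le> 2 * t - 1"
    using q0 degq t by (simp add: degree_mult_eq)
  ultimately have "integral {-1..1} (\<lambda>u. poly (q * q) u * (1 - u) ^ (?n - 1)) = 0"
    using cubature_zonal_average[OF cub F x _ N(1), of "q * q"] by simp
  then show False
    using integral_square_jacobi_weight_eq_0 q0 by blast
qed

theorem theorem6p1:
  fixes F :: "(real ^ ('n::finite option)) set"
    and w :: "real ^ ('n option) \<Rightarrow> real"
    and t :: nat and \<epsilon> :: real and J :: "real poly"
  assumes "1 \<le> t" and "0 < \<epsilon>" and "\<epsilon> < pi / 2"
    and "cubature_formula (2 * t - 1) F w"
    and "positive_weights F w \<and> interior_points F \<or> positive_weights F w \<and> boundary_points F"
    and "jacobi_polynomial (real CARD('n) - 1) 0 t J"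
    and "highest_zero J (cos (2 * \<epsilon>))"
  shows "simplex_net 4 \<epsilon> F"
  unfolding simplex_net_def
proof
  fix x :: "real ^ 'n option" assume x: "x \<in> std_simplex"
  have pos: "positive_weights F w" and F: "F \<subseteq> std_simplex"
    using assms(5) rel_interior_subset[of "std_simplex :: (real ^ 'n option) set"]
    by (auto simp: interior_points_def boundary_points_def)
  define S where "S = (\<lambda>p. \<Sum>k\<in>UNIV. sqrt (x $ k * p $ k))"
  obtain p where p: "p \<in> F" and le: "cos (2 * \<epsilon>) \<le> 2 * (S p)\<^sup>2 - 1"
    using cubature_point_near[OF assms(1,4) pos F x assms(6)] assms(7)
    by (auto simp: highest_zero_def S_def)
  have p': "p \<in> std_simplex" using p F by auto
  have "0 \<le> S p"
    using x p' by (auto simp: S_def std_simplex_def intro!: sum_nonneg)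
  \<comment> \<open>The double angle formula, with
    \<open>cos (2 * \<epsilon>) = 2 * (cos \<epsilon>)\<^sup>2 - 1\<close>.\<close>
  moreover have "(cos \<epsilon>)\<^sup>2 \<le> (S p)\<^sup>2"
    using le by (simp add: cos_double_cos)
  ultimately have "cos \<epsilon> \<le> S p"
    by (rule power2_le_imp_le[rotated])
  \<comment> \<open>Monotonicity of \<open>arccos\<close> requires arguments in [-1, 1]; the upper
    bound follows from the arithmetic-geometric mean inequality.\<close>
  moreover have "S p \<le> 1"
  proof -
    have "sqrt (x $ k * p $ k) \<le> (x $ k + p $ k) / 2" for k
      using x p' by (intro arith_geo_mean_sqrt) (auto simp: std_simplex_def)
    then have "S p \<le> (\<Sum>k\<in>UNIV. (x $ k + p $ k) / 2)"
      unfolding S_def by (rule sum_mono)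
    also have "\<dots> = 1"
      using x p' by (simp add: std_simplex_def sum.distrib flip: sum_divide_distrib)
    finally show ?thesis .
  qed
  ultimately have "arccos (S p) \<le> arccos (cos \<epsilon>)"
    by (intro arccos_le_arccos) auto
  also have "\<dots> = \<epsilon>"
    using assms(2,3) by (intro arccos_cos) auto
  finally have "ennreal (arccos (S p)) \<le> ennreal \<epsilon>"
    by (rule ennreal_leI)
  with simplex_dist_le_arccos[OF x p'] have "simplex_dist 4 x p \<le> ennreal \<epsilon>"
    unfolding S_def by (rule order_trans)
  then show "\<exists>p\<in>F. simplex_dist 4 x p \<le> ennreal \<epsilon>"
    using p by blast
qed

end
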